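(* Assume that $V_k^\alpha>-\infty$ for all $k=0,\ldots,n$ and all $\alpha\in\mathcal{A}$. Then for every $\alpha\in\mathcal{A}$ and every $k=0,\ldots,n$, $$V_k^\alpha = v_k\big(\mathbb{P}_{X_k^\alpha}\big),$$ where $(v_k)_{k=0,\ldots,n}$ is the sequence of (value) functions defined recursively on $\mathcal{P}_2(E)$ by $$v_n(\mu)=\hat g(\mu),\qquad v_k(\mu)=\inf_{\tilde\alpha\in A^E}\Big[\hat f_k(\mu,\tilde\alpha)+v_{k+1}\big(\Phi_{k+1}(\mu,\tilde\alpha)\big)\Big],\quad k=0,\ldots,n-1,\ \mu\in\mathcal{P}_2(E).$$
   Context: Setting. $(E,|\cdot|)$ is a normed space and $(A,|\cdot|)$ is a normed space (typically a subset of $\mathbb{R}^m$), with $\sigma$-algebras $\mathcal{B}(E)$, $\mathcal{B}(A)$. $\mathcal{P}(E)$, $\mathcal{P}(A)$ are the sets of probability measures on $E$, $A$; $\|\mu\|_2^2:=\int|x|^2\mu(dx)$, and $\mathcal{P}_2(E)$ (resp. $\mathcal{P}_2(A)$) is the set of $\mu$ with $\|\mu\|_2<\infty$. On a probability space $(\Omega,\mathcal{F},\mathbb{P})$, $(\varepsilon_k)_{k\ge1}$ is an i.i.d. sequence of $\mathbb{R}^d$-valued random variables, independent of a square integrable $E$-valued random variable $\xi$. $\mathbb{P}_Y$ denotes the law of a random variable $Y$. The maps $F_{k+1}:E\times\mathcal{P}(E)\times A\times\mathcal{P}(A)\times\mathbb{R}^d\to E$, $k\in\mathbb{N}$, are measurable,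 and $P_{k+1}(x,\mu,a,\lambda,dx')$ denotes the law of $F_{k+1}(x,\mu,a,\lambda,\varepsilon_{k+1})$. Standing assumptions. For each $k\in\mathbb{N}$ there is a constant $C_{k,F}>0$ with $\mathbb{E}\big[|F_{k+1}(x,\mu,a,\lambda,\varepsilon_{k+1})|^2\big]\le C_{k,F}(1+|x|^2+|a|^2+\|\mu\|_2^2+\|\lambda\|_2^2)$ for all $(x,\mu,a,\lambda)$. A horizon $n\ge1$ is fixed. The functions $f_k:E\times\mathcal{P}_2(E)\times A\times\mathcal{P}_2(A)\to\mathbb{R}$ ($k=0,\ldots,n-1$) and $g:E\times\mathcal{P}_2(E)\to\mathbb{R}$ are measurable with $|f_k(x,\mu,a,\lambda)|\le C_{k,f}(1+|x|^2+|a|^2+\|\mu\|_2^2+\|\lambda\|_2^2)$ and $|g(x,\mu)|\le C_g(1+|x|^2+\|\mu\|_2^2)$ for some positive constants. Controls. $A^E$ is the set of measurable functions $\tilde\alpha:E\to A$ with linear growth ($|\tilde\alpha(x)|\le C(1+|x|)$ for some $C$). $\mathcal{A}$ is the set of feedback controls, identified with sequences $\alpha=(\tilde\alpha_k)_{k\in\mathbb{N}}$ in $A^E$; the associated state process is $X_0^\alpha=\xi$, $X_{k+1}^\alpha=F_{k+1}(X_k^\alpha,\mathbb{P}_{X_k^\alpha},\alpha_k,\mathbb{P}_{\alpha_k},\varepsilon_{k+1})$ with $\alpha_k=\tilde\alpha_k(X_k^\alpha)$. Under the assumptions $\mathbb{P}_{X_k^\alpha}\in\mathcal{P}_2(E)$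 for all $k$. For $\tilde\alpha\in A^E$ and $\mu\in\mathcal{P}_2(E)$, $\tilde\alpha\star\mu\in\mathcal{P}_2(A)$ is the image (pushforward) of $\mu$ by $\tilde\alpha$. Deterministic reformulation. $\hat f_k(\mu,\tilde\alpha):=\int_E f_k(x,\mu,\tilde\alpha(x),\tilde\alpha\star\mu)\,\mu(dx)$, $\hat g(\mu):=\int_E g(x,\mu)\,\mu(dx)$, and $\Phi_{k+1}(\mu,\tilde\alpha)(dx'):=\int_E\mu(dx)\,P_{k+1}(x,\mu,\tilde\alpha(x),\tilde\alpha\star\mu,dx')$, an element of $\mathcal{P}_2(E)$, for $\mu\in\mathcal{P}_2(E)$, $\tilde\alpha\in A^E$. For $\alpha=(\tilde\alpha_k)_k\in\mathcal{A}$ and $k=0,\ldots,n$, $\mathcal{A}_k(\alpha)=\{\beta\in\mathcal{A}:\beta_j=\alpha_j,\ j=0,\ldots,k-1\}$ (so $\mathcal{A}_0(\alpha)=\mathcal{A}$), and $$V_k^\alpha:=\inf_{\beta\in\mathcal{A}_k(\alpha)}\Big[\sum_{j=k}^{n-1}\hat f_j(\mathbb{P}_{X_j^\beta},\tilde\beta_j)+\hat g(\mathbb{P}_{X_n^\beta})\Big].$$ The functions $v_k$ are a priori valued in $[-\infty,\infty)$. *)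

theory Defs
  imports "HOL-Probability.Probability"
begin

text \<open>
  The state space \<open>E\<close> is a whole normed space, rendered as a type. The action space is a subset
  \<open>A\<close> of a normed space (\<open>A = UNIV\<close> being allowed) with the trace of the Borel sigma-algebra.
  Sets of probability measures carry the sigma-algebra generated by the evaluation maps
  (\<^const>\<open>prob_algebra\<close>).
\<close>

abbreviation action_space :: "'a::real_normed_vector set \<Rightarrow> 'a measure" where
  "action_space A \<equiv> restrict_space borel A"

abbreviation probs :: "'b measure \<Rightarrow> 'b measure set" where
  "probs S \<equiv> space (prob_algebra S)"

text \<open>\<open>second_moment \<mu>\<close> is the squared norm \<open>\<parallel>\<mu>\<parallel>\<^sub>2\<^sup>2\<close>, possibly infinite.\<close>

definition second_moment :: "'b::real_normed_vector measure \<Rightarrow> ennreal" where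
  "second_moment \<mu> = (\<integral>\<^sup>+x. ennreal ((norm x)\<^sup>2) \<partial>\<mu>)"

definition probs2 :: "'b::real_normed_vector measure \<Rightarrow> 'b measure set" where
  "probs2 S = {\<mu> \<in> probs S. second_moment \<mu> < \<infinity>}"

definition prob_algebra2 :: "'b::real_normed_vector measure \<Rightarrow> 'b measure measure" where
  "prob_algebra2 S = restrict_space (prob_algebra S) (probs2 S)"

definition policies :: "'a::real_normed_vector set \<Rightarrow> ('e::real_normed_vector \<Rightarrow> 'a) set" where
  "policies A = {a \<in> borel \<rightarrow>\<^sub>M action_space A. \<exists>C. \<forall>x. norm (a x) \<le> C * (1 + norm x)}"

definition controls :: "'a::real_normed_vector set \<Rightarrow> (nat \<Rightarrow> 'e::real_normed_vector \<Rightarrow> 'a) set" where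
  "controls A = {\<alpha>. \<forall>k. \<alpha> k \<in> policies A}"

primrec state ::
  "'w measure \<Rightarrow> 'a::real_normed_vector set
   \<Rightarrow> (nat \<Rightarrow> 'e::real_normed_vector \<Rightarrow> 'e measure \<Rightarrow> 'a \<Rightarrow> 'a measure \<Rightarrow> real ^ 'd \<Rightarrow> 'e)
   \<Rightarrow> (nat \<Rightarrow> 'w \<Rightarrow> real ^ 'd) \<Rightarrow> ('w \<Rightarrow> 'e) \<Rightarrow> (nat \<Rightarrow> 'e \<Rightarrow> 'a) \<Rightarrow> nat \<Rightarrow> 'w \<Rightarrow> 'e" where
  "state M A F \<epsilon> \<xi> \<alpha> 0 = \<xi>"
| "state M A F \<epsilon> \<xi> \<alpha> (Suc k) =
     (let X = state M A F \<epsilon> \<xi> \<alpha> k; U = (\<lambda>\<omega>. \<alpha> k (X \<omega>)) in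
      (\<lambda>\<omega>. F (Suc k) (X \<omega>) (distr M borel X) (U \<omega>) (distr M (action_space A) U) (\<epsilon> (Suc k) \<omega>)))"

definition state_law ::
  "'w measure \<Rightarrow> 'a::real_normed_vector set
   \<Rightarrow> (nat \<Rightarrow> 'e::real_normed_vector \<Rightarrow> 'e measure \<Rightarrow> 'a \<Rightarrow> 'a measure \<Rightarrow> real ^ 'd \<Rightarrow> 'e)
   \<Rightarrow> (nat \<Rightarrow> 'w \<Rightarrow> real ^ 'd) \<Rightarrow> ('w \<Rightarrow> 'e) \<Rightarrow> (nat \<Rightarrow> 'e \<Rightarrow> 'a) \<Rightarrow> nat \<Rightarrow> 'e measure" where
  "state_law M A F \<epsilon> \<xi> \<alpha> k = distr M borel (state M A F \<epsilon> \<xi> \<alpha> k)"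

definition transition ::
  "'w measure
   \<Rightarrow> (nat \<Rightarrow> 'e::real_normed_vector \<Rightarrow> 'e measure \<Rightarrow> 'a::real_normed_vector \<Rightarrow> 'a measure
        \<Rightarrow> real ^ 'd \<Rightarrow> 'e)
   \<Rightarrow> (nat \<Rightarrow> 'w \<Rightarrow> real ^ 'd) \<Rightarrow> nat \<Rightarrow> 'e \<Rightarrow> 'e measure \<Rightarrow> 'a \<Rightarrow> 'a measure \<Rightarrow> 'e measure" where
  "transition M F \<epsilon> k x \<mu> a l = distr M borel (\<lambda>\<omega>. F k x \<mu> a l (\<epsilon> k \<omega>))"

definition push :: "'a::real_normed_vector set \<Rightarrow> ('e::real_normed_vector \<Rightarrow> 'a) \<Rightarrow> 'e measure \<Rightarrow> 'a measure" where
  "push A a \<mu> = distr \<mu> (action_space A) a"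

definition f_hat ::
  "'a::real_normed_vector set
   \<Rightarrow> (nat \<Rightarrow> 'e::real_normed_vector \<Rightarrow> 'e measure \<Rightarrow> 'a \<Rightarrow> 'a measure \<Rightarrow> real)
   \<Rightarrow> nat \<Rightarrow> 'e measure \<Rightarrow> ('e \<Rightarrow> 'a) \<Rightarrow> real" where
  "f_hat A f k \<mu> a = (\<integral>x. f k x \<mu> (a x) (push A a \<mu>) \<partial>\<mu>)"

definition g_hat :: "('e::real_normed_vector \<Rightarrow> 'e measure \<Rightarrow> real) \<Rightarrow> 'e measure \<Rightarrow> real" where
  "g_hat g \<mu> = (\<integral>x. g x \<mu> \<partial>\<mu>)"

definition Phi ::
  "'w measure \<Rightarrow> 'a::real_normed_vector set
   \<Rightarrow> (nat \<Rightarrow> 'e::real_normed_vector \<Rightarrow> 'e measure \<Rightarrow> 'a \<Rightarrow> 'a measure \<Rightarrow> real ^ 'd \<Rightarrow> 'e)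
   \<Rightarrow> (nat \<Rightarrow> 'w \<Rightarrow> real ^ 'd) \<Rightarrow> nat \<Rightarrow> 'e measure \<Rightarrow> ('e \<Rightarrow> 'a) \<Rightarrow> 'e measure" where
  "Phi M A F \<epsilon> k \<mu> a = bind \<mu> (\<lambda>x. transition M F \<epsilon> k x \<mu> (a x) (push A a \<mu>))"

definition controls_from ::
  "'a::real_normed_vector set \<Rightarrow> nat \<Rightarrow> (nat \<Rightarrow> 'e::real_normed_vector \<Rightarrow> 'a)
   \<Rightarrow> (nat \<Rightarrow> 'e \<Rightarrow> 'a) set" where
  "controls_from A k \<alpha> = {\<beta> \<in> controls A. \<forall>j<k. \<beta> j = \<alpha> j}"

definition dyn_value ::
  "'w measure \<Rightarrow> 'a::real_normed_vector set
   \<Rightarrow> (nat \<Rightarrow> 'e::real_normed_vector \<Rightarrow> 'e measure \<Rightarrow> 'a \<Rightarrow> 'a measure \<Rightarrow> real ^ 'd \<Rightarrow> 'e)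
   \<Rightarrow> (nat \<Rightarrow> 'w \<Rightarrow> real ^ 'd) \<Rightarrow> ('w \<Rightarrow> 'e)
   \<Rightarrow> (nat \<Rightarrow> 'e \<Rightarrow> 'e measure \<Rightarrow> 'a \<Rightarrow> 'a measure \<Rightarrow> real) \<Rightarrow> ('e \<Rightarrow> 'e measure \<Rightarrow> real)
   \<Rightarrow> nat \<Rightarrow> nat \<Rightarrow> (nat \<Rightarrow> 'e \<Rightarrow> 'a) \<Rightarrow> ereal" where
  "dyn_value M A F \<epsilon> \<xi> f g n k \<alpha> =
     (INF \<beta> \<in> controls_from A k \<alpha>.
        ereal ((\<Sum>j=k..<n. f_hat A f j (state_law M A F \<epsilon> \<xi> \<beta> j) (\<beta> j))
               + g_hat g (state_law M A F \<epsilon> \<xi> \<beta> n)))"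

text \<open>Only the values at \<open>k \<le> n\<close> and at measures in \<open>probs2 borel\<close> are meaningful.\<close>

function value_fun ::
  "'w measure \<Rightarrow> 'a::real_normed_vector set
   \<Rightarrow> (nat \<Rightarrow> 'e::real_normed_vector \<Rightarrow> 'e measure \<Rightarrow> 'a \<Rightarrow> 'a measure \<Rightarrow> real ^ 'd \<Rightarrow> 'e)
   \<Rightarrow> (nat \<Rightarrow> 'w \<Rightarrow> real ^ 'd)
   \<Rightarrow> (nat \<Rightarrow> 'e \<Rightarrow> 'e measure \<Rightarrow> 'a \<Rightarrow> 'a measure \<Rightarrow> real) \<Rightarrow> ('e \<Rightarrow> 'e measure \<Rightarrow> real)
   \<Rightarrow> nat \<Rightarrow> nat \<Rightarrow> 'e measure \<Rightarrow> ereal" where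
  "value_fun M A F \<epsilon> f g n k \<mu> =
     (if k < n
      then (INF a \<in> policies A.
              ereal (f_hat A f k \<mu> a)
              + value_fun M A F \<epsilon> f g n (Suc k) (Phi M A F \<epsilon> (Suc k) \<mu> a))
      else ereal (g_hat g \<mu>))"
  by pat_completeness auto
termination
  by (relation "Wellfounded.measure (\<lambda>(M, A, F, \<epsilon>, f, g, n, k, \<mu>). n - k)") auto

declare value_fun.simps [simp del]

end

theory Submission
  imports Defs
begin

text \<open>
  The noise \<open>\<epsilon> (Suc k)\<close> is independent of \<open>(\<xi>, \<epsilon> 1, \<dots>, \<epsilon> k)\<close>, which determine the state at
  time \<open>k\<close>. Hence the law of the next state is the mixture of the transition kernels over the law
  of the present one, and depends on the past only through that law and the current policy: the
  laws follow the deterministic dynamics \<open>Phi\<close>. Splitting the infimum over continuations at time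
  \<open>k\<close> according to the policy used at that time then gives the Bellman recursion by backward
  induction. All costs are real numbers, so they move freely out of infima in \<open>ereal\<close>.
\<close>

section \<open>Infima of extended reals, and laws of functions of independent variables\<close>

text \<open>This is the rule for infima of \<open>c - h i\<close>, read with
  \<open>h i = - f i\<close>: the supremum of the negatives is the negated infimum. It pulls the
  cost of one period out of the infimum over continuations, whose own value may be infinite.\<close>

lemma INF_ereal_add_const:
  fixes f :: "'i \<Rightarrow> ereal"
  assumes "I \<noteq> {}" "\<bar>c\<bar> \<noteq> \<infinity>"
  shows "(INF i\<in>I. c + f i) = c + (INF i\<in>I. f i)"
  using INF_ereal_minus_right[OF assms, of "\<lambda>i. - f i"]
  by (simp add: ereal_SUP_uminus_eq minus_ereal_def)

text \<open>
  The library's \<open>indep_var\<close> only relates random variables with values in the same type, so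
  independence of the state and the noise is expressed by factorization of the joint law.
\<close>

lemma (in prob_space) pair_distr_eq_distr_pair:
  assumes indep: "indep_set \<A> \<B>"
    and X: "X \<in> M \<rightarrow>\<^sub>M S" "\<And>B. B \<in> sets S \<Longrightarrow> X -` B \<inter> space M \<in> \<A>"
    and Y: "Y \<in> M \<rightarrow>\<^sub>M T" "\<And>B. B \<in> sets T \<Longrightarrow> Y -` B \<inter> space M \<in> \<B>"
  shows "distr M S X \<Otimes>\<^sub>M distr M T Y = distr M (S \<Otimes>\<^sub>M T) (\<lambda>\<omega>. (X \<omega>, Y \<omega>))"
proof (rule pair_measure_eqI)
  show "sigma_finite_measure (distr M S X)" "sigma_finite_measure (distr M T Y)"
    using prob_space_distr[OF X(1)] prob_space_distr[OF Y(1)]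
    by (auto dest: prob_space_imp_sigma_finite)
  show "sets (distr M S X \<Otimes>\<^sub>M distr M T Y) = sets (distr M (S \<Otimes>\<^sub>M T) (\<lambda>\<omega>. (X \<omega>, Y \<omega>)))"
    by (simp cong: sets_pair_measure_cong)
next
  fix A B assume "A \<in> sets (distr M S X)" "B \<in> sets (distr M T Y)"
  then have A: "A \<in> sets S" and B: "B \<in> sets T" by auto
  have "(\<lambda>\<omega>. (X \<omega>, Y \<omega>)) -` (A \<times> B) \<inter> space M = (X -` A \<inter> space M) \<inter> (Y -` B \<inter> space M)"
    by auto
  moreover have "prob ((X -` A \<inter> space M) \<inter> (Y -` B \<inter> space M))
      = prob (X -` A \<inter> space M) * prob (Y -` B \<inter> space M)"
    by (rule indep_setD[OF indep X(2)[OF A] Y(2)[OF B]])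
  ultimately show "emeasure (distr M S X) A * emeasure (distr M T Y) B
      = emeasure (distr M (S \<Otimes>\<^sub>M T) (\<lambda>\<omega>. (X \<omega>, Y \<omega>))) (A \<times> B)"
    using A B X(1) Y(1)
    by (simp add: emeasure_distr measurable_Pair emeasure_eq_measure ennreal_mult')
qed

text \<open>Fubini: under a product law, \<open>Y\<close> keeps its law when \<open>X\<close> is
  frozen at \<open>x\<close>, so the law of \<open>H X Y\<close> is the mixture of the laws of
  \<open>H x Y\<close>. Applied to the state and the next noise, this mixture is
  \<open>Phi\<close>.\<close>

lemma (in prob_space) distr_eq_bind_if_product_law:
  assumes X: "X \<in> M \<rightarrow>\<^sub>M S" and Y: "Y \<in> M \<rightarrow>\<^sub>M T"
    and joint: "distr M S X \<Otimes>\<^sub>M distr M T Y = distr M (S \<Otimes>\<^sub>M T) (\<lambda>\<omega>. (X \<omega>, Y \<omega>))"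
    and H: "(\<lambda>(x, y). H x y) \<in> S \<Otimes>\<^sub>M T \<rightarrow>\<^sub>M N"
  shows "distr M N (\<lambda>\<omega>. H (X \<omega>) (Y \<omega>)) = distr M S X \<bind> (\<lambda>x. distr M N (\<lambda>\<omega>. H x (Y \<omega>)))"
    (is "?L = ?R")
proof -
  interpret pX: prob_space "distr M S X" by (rule prob_space_distr[OF X])
  interpret pY: prob_space "distr M T Y" by (rule prob_space_distr[OF Y])
  have slice: "H x \<in> T \<rightarrow>\<^sub>M N" if "x \<in> space S" for x
    using measurable_Pair2[OF H that] by simp
  \<comment> \<open>As images of one fixed measure, the law of \<open>Y\<close>, the kernels inherit
    measurability in \<open>x\<close> from the joint measurability of \<open>H\<close>.\<close>
  have kernel_eq: "distr M N (\<lambda>\<omega>. H x (Y \<omega>)) = distr (distr M T Y) N (H x)"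
    if "x \<in> space S" for x
    using distr_distr[OF slice[OF that] Y] by (simp add: comp_def)
  have "(\<lambda>x. distr (distr M T Y) N (H x)) \<in> S \<rightarrow>\<^sub>M prob_algebra N"
    by (rule measurable_distr_prob_space2[OF _ H])
       (auto simp: space_prob_algebra pY.prob_space_axioms)
  then have kernel: "(\<lambda>x. distr M N (\<lambda>\<omega>. H x (Y \<omega>))) \<in> S \<rightarrow>\<^sub>M prob_algebra N"
    by (subst measurable_cong[OF kernel_eq])
  have law: "distr M S X \<in> space (prob_algebra S)"
    by (simp add: space_prob_algebra pX.prob_space_axioms)
  show ?thesis
  proof (rule measure_eqI)
    show "sets ?L = sets ?R"
      by (simp add: sets_bind'[OF law kernel])
    fix B assume "B \<in> sets ?L"
    then have B: "B \<in> sets N" by simp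
    let ?D = "(\<lambda>(x, y). H x y) -` B \<inter> space (S \<Otimes>\<^sub>M T)"
    have D: "?D \<in> sets (S \<Otimes>\<^sub>M T)" by (rule measurable_sets[OF H B])
    have XY: "(\<lambda>\<omega>. (X \<omega>, Y \<omega>)) \<in> M \<rightarrow>\<^sub>M S \<Otimes>\<^sub>M T" using X Y by (rule measurable_Pair)
    have HXY: "(\<lambda>\<omega>. H (X \<omega>) (Y \<omega>)) \<in> M \<rightarrow>\<^sub>M N"
      using measurable_compose[OF XY H] by simp
    have "emeasure ?L B = emeasure (distr M (S \<Otimes>\<^sub>M T) (\<lambda>\<omega>. (X \<omega>, Y \<omega>))) ?D"
      using measurable_space[OF XY]
      by (auto simp: emeasure_distr[OF HXY B] emeasure_distr[OF XY D]
               intro!: arg_cong[where f = "emeasure M"])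
    \<comment> \<open>Independence enters here: the joint law is replaced by the product, whose
      value on \<open>?D\<close> is an integral over sections.\<close>
    also have "\<dots> = (\<integral>\<^sup>+x. emeasure (distr M T Y) (Pair x -` ?D) \<partial>distr M S X)"
      unfolding joint[symmetric]
      by (rule pY.emeasure_pair_measure_alt) (use D in \<open>simp cong: sets_pair_measure_cong\<close>)
    also have "\<dots> = (\<integral>\<^sup>+x. emeasure (distr M N (\<lambda>\<omega>. H x (Y \<omega>))) B \<partial>distr M S X)"
    proof (rule nn_integral_cong)
      fix x assume "x \<in> space (distr M S X)"
      then have x: "x \<in> space S" by simp
      then have "Pair x -` ?D = H x -` B \<inter> space T"
        by (auto simp: space_pair_measure)
      then show "emeasure (distr M T Y) (Pair x -` ?D) = emeasure (distr M N (\<lambda>\<omega>. H x (Y \<omega>))) B"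
        by (simp add: kernel_eq[OF x] emeasure_distr[of "H x"] slice[OF x] B)
    qed
    also have "\<dots> = emeasure ?R B"
      by (rule emeasure_bind_prob_algebra[OF law kernel B, symmetric])
    finally show "emeasure ?L B = emeasure ?R B" .
  qed
qed

section \<open>Controls that share an initial segment\<close>

text \<open>The policy \<open>\<alpha> k\<close> first acts in passing from time \<open>k\<close> to
  \<open>Suc k\<close>. Hence changing it leaves the state at time \<open>k\<close> untouched, which
  is what the Bellman step relies on.\<close>

lemma state_cong:
  "(\<And>j. j < k \<Longrightarrow> \<alpha> j = \<beta> j) \<Longrightarrow> state M A F \<epsilon> \<xi> \<alpha> k = state M A F \<epsilon> \<xi> \<beta> k"
  by (induction k) (simp_all add: Let_def)

lemma state_law_cong:
  "(\<And>j. j < k \<Longrightarrow> \<alpha> j = \<beta> j) \<Longrightarrow> state_law M A F \<epsilon> \<xi> \<alpha> k = state_law M A F \<epsilon> \<xi> \<beta> k"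
  using state_cong[of k \<alpha> \<beta> M A F \<epsilon> \<xi>] by (simp add: state_law_def)

lemma state_law_controls_from:
  "\<beta> \<in> controls_from A k \<alpha> \<Longrightarrow> state_law M A F \<epsilon> \<xi> \<beta> k = state_law M A F \<epsilon> \<xi> \<alpha> k"
  by (rule state_law_cong) (simp add: controls_from_def)

lemma controls_from_self: "\<alpha> \<in> controls A \<Longrightarrow> \<alpha> \<in> controls_from A k \<alpha>"
  by (simp add: controls_from_def)

lemma controls_fun_upd: "\<alpha> \<in> controls A \<Longrightarrow> a \<in> policies A \<Longrightarrow> \<alpha>(k := a) \<in> controls A"
  by (simp add: controls_def)

text \<open>Each continuation \<open>\<beta>\<close> is filed under the policy
  \<open>\<beta> k\<close> that it uses at time \<open>k\<close>, which turns one infimum over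
  continuations into an iterated one.\<close>

lemma controls_from_split:
  "controls_from A k \<alpha> = (\<Union>a\<in>policies A. controls_from A (Suc k) (\<alpha>(k := a)))"
proof (intro subset_antisym subsetI)
  fix \<beta> assume "\<beta> \<in> controls_from A k \<alpha>"
  then have "\<beta> k \<in> policies A" "\<beta> \<in> controls_from A (Suc k) (\<alpha>(k := \<beta> k))"
    by (simp_all add: controls_from_def controls_def less_Suc_eq)
  then show "\<beta> \<in> (\<Union>a\<in>policies A. controls_from A (Suc k) (\<alpha>(k := a)))" by blast
next
  fix \<beta> assume "\<beta> \<in> (\<Union>a\<in>policies A. controls_from A (Suc k) (\<alpha>(k := a)))"
  then obtain a where "\<beta> \<in> controls_from A (Suc k) (\<alpha>(k := a))" by blast
  then show "\<beta> \<in> controls_from A k \<alpha>"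
    by (simp add: controls_from_def)
qed

section \<open>Bellman recursion along controls\<close>

text \<open>At time \<open>n\<close> the sum is empty and all admissible continuations have the same
  law, so the infimum is over a constant.\<close>

lemma dyn_value_terminal:
  assumes "\<alpha> \<in> controls A"
  shows "dyn_value M A F \<epsilon> \<xi> f g n n \<alpha> = ereal (g_hat g (state_law M A F \<epsilon> \<xi> \<alpha> n))"
proof -
  have "dyn_value M A F \<epsilon> \<xi> f g n n \<alpha>
      = (INF \<beta>\<in>controls_from A n \<alpha>. ereal (g_hat g (state_law M A F \<epsilon> \<xi> \<alpha> n)))"
    unfolding dyn_value_def by (intro INF_cong refl) (simp add: state_law_controls_from)
  also have "\<dots> = ereal (g_hat g (state_law M A F \<epsilon> \<xi> \<alpha> n))"
    using controls_from_self[OF assms] by (intro INF_const) auto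
  finally show ?thesis .
qed

text \<open>Within the block of continuations that use \<open>a\<close> at time \<open>k\<close>,
  the cost of that period is constant, because the law at time \<open>k\<close> is fixed by the
  common past. It therefore leaves the inner infimum. The continuation value still refers to a
  control here, not yet to a law.\<close>

lemma dyn_value_step:
  assumes \<alpha>: "\<alpha> \<in> controls A" and "k < n"
  shows "dyn_value M A F \<epsilon> \<xi> f g n k \<alpha>
    = (INF a\<in>policies A. ereal (f_hat A f k (state_law M A F \<epsilon> \<xi> \<alpha> k) a)
                          + dyn_value M A F \<epsilon> \<xi> f g n (Suc k) (\<alpha>(k := a)))"
proof -
  define J where "J m \<beta> = (\<Sum>j=m..<n. f_hat A f j (state_law M A F \<epsilon> \<xi> \<beta> j) (\<beta> j))
      + g_hat g (state_law M A F \<epsilon> \<xi> \<beta> n)" for m \<beta>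
  have V: "dyn_value M A F \<epsilon> \<xi> f g n m \<beta> = (INF \<gamma>\<in>controls_from A m \<beta>. ereal (J m \<gamma>))" for m \<beta>
    by (simp add: dyn_value_def J_def)
  have step: "(INF \<beta>\<in>controls_from A (Suc k) (\<alpha>(k := a)). ereal (J k \<beta>))
      = ereal (f_hat A f k (state_law M A F \<epsilon> \<xi> \<alpha> k) a)
        + dyn_value M A F \<epsilon> \<xi> f g n (Suc k) (\<alpha>(k := a))" (is "_ = ereal ?c + _")
    if a: "a \<in> policies A" for a
  proof -
    let ?B = "controls_from A (Suc k) (\<alpha>(k := a))"
    have "J k \<beta> = ?c + J (Suc k) \<beta>" if "\<beta> \<in> ?B" for \<beta>
    proof -
      have "\<beta> k = a" "state_law M A F \<epsilon> \<xi> \<beta> k = state_law M A F \<epsilon> \<xi> \<alpha> k"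
        using that by (auto simp: controls_from_def intro!: state_law_cong)
      then show ?thesis
        using \<open>k < n\<close> by (simp add: J_def sum.atLeast_Suc_lessThan)
    qed
    then have "(INF \<beta>\<in>?B. ereal (J k \<beta>)) = (INF \<beta>\<in>?B. ereal ?c + ereal (J (Suc k) \<beta>))"
      by (intro INF_cong refl) simp
    \<comment> \<open>The block is nonempty: it contains \<open>\<alpha>(k := a)\<close>
      itself.\<close>
    also have "\<dots> = ereal ?c + (INF \<beta>\<in>?B. ereal (J (Suc k) \<beta>))"
      using controls_from_self[OF controls_fun_upd[OF \<alpha> a]]
      by (intro INF_ereal_add_const) auto
    finally show ?thesis by (simp add: V)
  qed
  have "dyn_value M A F \<epsilon> \<xi> f g n k \<alpha>
      = (INF a\<in>policies A. INF \<beta>\<in>controls_from A (Suc k) (\<alpha>(k := a)). ereal (J k \<beta>))"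
    unfolding V[of k \<alpha>] controls_from_split[of A k \<alpha>]
    by (rule antisym) (blast intro: INF_greatest INF_lower2)+
  also have "\<dots> = (INF a\<in>policies A. ereal (f_hat A f k (state_law M A F \<epsilon> \<xi> \<alpha> k) a)
      + dyn_value M A F \<epsilon> \<xi> f g n (Suc k) (\<alpha>(k := a)))"
    by (intro INF_cong refl step)
  finally show ?thesis .
qed

section \<open>Initial state and noises as jointly independent sources\<close>

locale mean_field_chain = prob_space M
  for M :: "'w measure" +
  fixes A :: "'a::real_normed_vector set"
    and F :: "nat \<Rightarrow> 'e::real_normed_vector \<Rightarrow> 'e measure \<Rightarrow> 'a \<Rightarrow> 'a measure \<Rightarrow> real ^ 'd \<Rightarrow> 'e"
    and \<epsilon> :: "nat \<Rightarrow> 'w \<Rightarrow> real ^ 'd"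
    and \<xi> :: "'w \<Rightarrow> 'e"
  assumes \<epsilon>_indep: "indep_vars (\<lambda>_. borel) \<epsilon> {1..}"
    and \<xi>_meas: "\<xi> \<in> M \<rightarrow>\<^sub>M borel"
    and \<xi>_\<epsilon>_indep: "indep_set
          (sets (vimage_algebra (space M) \<xi> borel))
          (sets (vimage_algebra (space M) (\<lambda>\<omega>. \<lambda>k\<in>{1..}. \<epsilon> k \<omega>) (\<Pi>\<^sub>M k\<in>{1..}. borel)))"
    and F_meas: "\<And>k. (\<lambda>(x, \<mu>, a, l, e). F (Suc k) x \<mu> a l e)
          \<in> borel \<Otimes>\<^sub>M prob_algebra borel \<Otimes>\<^sub>M action_space A \<Otimes>\<^sub>M prob_algebra (action_space A) \<Otimes>\<^sub>M borel
            \<rightarrow>\<^sub>M borel"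
begin

text \<open>Index 0 is the initial state, and index \<open>k \<ge> 1\<close> the noise at time \<open>k\<close>.\<close>

definition source :: "nat \<Rightarrow> 'w set set" where
  "source i = (if i = 0 then {\<xi> -` B \<inter> space M | B. B \<in> sets borel}
               else {\<epsilon> i -` B \<inter> space M | B. B \<in> sets borel})"

text \<open>The natural filtration of the data. It is generated by a union of sources rather than by
  a tuple-valued variable, so that independence of disjoint groups of sources applies to it
  directly.\<close>

definition past :: "nat \<Rightarrow> 'w measure" where
  "past k = sigma (space M) (\<Union>i\<le>k. source i)"

lemma \<epsilon>_meas: "k \<ge> 1 \<Longrightarrow> \<epsilon> k \<in> M \<rightarrow>\<^sub>M borel"
  using \<epsilon>_indep by (simp add: indep_vars_def)

lemma source_events: "source i \<subseteq> events"
  using measurable_sets[OF \<xi>_meas] measurable_sets[OF \<epsilon>_meas] by (auto simp: source_def)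

lemma Int_stable_preimages: "Int_stable {h -` B \<inter> \<Omega> | B. B \<in> sets N}"
proof (rule Int_stableI)
  fix a b
  assume "a \<in> {h -` B \<inter> \<Omega> | B. B \<in> sets N}" "b \<in> {h -` B \<inter> \<Omega> | B. B \<in> sets N}"
  then obtain A B where "A \<in> sets N" "B \<in> sets N" "a = h -` A \<inter> \<Omega>" "b = h -` B \<inter> \<Omega>"
    by blast
  then have "a \<inter> b = h -` (A \<inter> B) \<inter> \<Omega>" "A \<inter> B \<in> sets N" by auto
  then show "a \<inter> b \<in> {h -` B \<inter> \<Omega> | B. B \<in> sets N}" by blast
qed

lemma Int_stable_source: "Int_stable (source i)"
  unfolding source_def by (simp add: Int_stable_preimages)

text \<open>Two assumptions merge into one: splitting off index 0 uses that \<open>\<xi>\<close> is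
  independent of the whole noise sequence, and the remaining product formula is the mutual
  independence of the noises.\<close>

lemma indep_sets_source: "indep_sets source UNIV"
proof (rule indep_setsI)
  show "source i \<subseteq> events" for i by (rule source_events)
  fix E J assume J: "J \<noteq> {}" "finite J" and E: "\<forall>j\<in>J. E j \<in> source j"
  let ?\<epsilon> = "sets (vimage_algebra (space M) (\<lambda>\<omega>. \<lambda>k\<in>{1..}. \<epsilon> k \<omega>) (\<Pi>\<^sub>M k\<in>{1..}. borel))"
  have noise: "prob (\<Inter>j\<in>K. E j) = (\<Prod>j\<in>K. prob (E j))"
    if K: "K \<noteq> {}" "K \<subseteq> J" "0 \<notin> K" for K
  proof (rule indep_setsD)
    show "indep_sets (\<lambda>i. {\<epsilon> i -` B \<inter> space M | B. B \<in> sets borel}) {1..}"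
      using \<epsilon>_indep unfolding indep_vars_def2 by simp
    show "K \<subseteq> {1..}"
    proof
      fix i assume "i \<in> K"
      with \<open>0 \<notin> K\<close> have "i \<noteq> 0" by metis
      then show "i \<in> {1..}" by simp
    qed
    show "K \<noteq> {}" "finite K" using K(1) finite_subset[OF K(2)] J(2) by auto
    show "\<forall>j\<in>K. E j \<in> {\<epsilon> j -` B \<inter> space M | B. B \<in> sets borel}"
    proof
      fix j assume "j \<in> K"
      with K have "j \<in> J" "j \<noteq> 0" by (blast, metis)
      with E have "E j \<in> source j" by blast
      with \<open>j \<noteq> 0\<close> show "E j \<in> {\<epsilon> j -` B \<inter> space M | B. B \<in> sets borel}" by (simp add: source_def)
    qed
  qed
  \<comment> \<open>An event of one noise is an event of the whole sequence, since coordinate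
    projections are measurable. Only in this form can it be paired with an event of
    \<open>\<xi>\<close>.\<close>
  have coord: "E j \<in> ?\<epsilon>" if "j \<in> J" "j \<noteq> 0" for j
  proof -
    obtain B where B: "B \<in> sets borel" "E j = \<epsilon> j -` B \<inter> space M"
      using bspec[OF E \<open>j \<in> J\<close>] \<open>j \<noteq> 0\<close> by (auto simp: source_def)
    have "(\<lambda>\<omega>. \<lambda>k\<in>{1..}. \<epsilon> k \<omega>)
        \<in> vimage_algebra (space M) (\<lambda>\<omega>. \<lambda>k\<in>{1..}. \<epsilon> k \<omega>) (\<Pi>\<^sub>M k\<in>{1..}. borel) \<rightarrow>\<^sub>M (\<Pi>\<^sub>M k\<in>{1..}. borel)"
      by (rule measurable_vimage_algebra1) (auto simp: space_PiM)
    from measurable_compose[OF this measurable_component_singleton[of j]] that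
    have "\<epsilon> j \<in> vimage_algebra (space M) (\<lambda>\<omega>. \<lambda>k\<in>{1..}. \<epsilon> k \<omega>) (\<Pi>\<^sub>M k\<in>{1..}. borel) \<rightarrow>\<^sub>M borel"
      by simp
    from measurable_sets[OF this B(1)] B(2) show ?thesis by simp
  qed
  show "prob (\<Inter>j\<in>J. E j) = (\<Prod>j\<in>J. prob (E j))"
  proof (cases "0 \<in> J")
    case False
    then show ?thesis using noise[of J] J by simp
  next
    case True
    define K where "K = J - {0}"
    have JK: "J = insert 0 K" and K: "finite K" "0 \<notin> K" "K \<subseteq> J"
      using True J by (auto simp: K_def)
    \<comment> \<open>The intersection over an empty \<open>K\<close> is the whole type, which need
      not be an event, so this case is treated apart.\<close>
    show ?thesis
    proof (cases "K = {}")
      case True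
      then show ?thesis by (simp add: JK)
    next
      case False
      have "(\<Inter>j\<in>K. E j) \<in> ?\<epsilon>"
        using K False by (intro sets.finite_INT coord) (auto simp: K_def)
      moreover have "E 0 \<in> sets (vimage_algebra (space M) \<xi> borel)"
        using bspec[OF E True] by (auto simp: source_def intro: in_vimage_algebra)
      ultimately have "prob (E 0 \<inter> (\<Inter>j\<in>K. E j)) = prob (E 0) * prob (\<Inter>j\<in>K. E j)"
        by (intro indep_setD[OF \<xi>_\<epsilon>_indep])
      then have "prob (E 0 \<inter> (\<Inter>j\<in>K. E j)) = prob (E 0) * (\<Prod>j\<in>K. prob (E j))"
        by (simp only: noise[OF False K(3,2)])
      then show ?thesis
        unfolding JK using K(1,2) by simp
    qed
  qed
qed

lemma space_past [simp]: "space (past k) = space M"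
  by (simp add: past_def space_measure_of_conv)

lemma sets_past: "sets (past k) = sigma_sets (space M) (\<Union>i\<le>k. source i)"
  unfolding past_def
  by (intro sets_measure_of UN_least order_trans[OF source_events] sets.space_closed)

lemma past_mono: "j \<le> k \<Longrightarrow> sets (past j) \<subseteq> sets (past k)"
  unfolding sets_past by (intro sigma_sets_mono' UN_mono) auto

lemma past_events: "sets (past k) \<subseteq> events"
  unfolding sets_past using source_events by (intro sets.sigma_sets_subset) auto

lemma \<xi>_past: "\<xi> \<in> past k \<rightarrow>\<^sub>M borel"
  by (rule measurableI) (auto simp: sets_past source_def intro!: sigma_sets.Basic UN_I[of 0])

lemma \<epsilon>_past:
  assumes "1 \<le> j" "j \<le> k"
  shows "\<epsilon> j \<in> past k \<rightarrow>\<^sub>M borel"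
proof (rule measurableI)
  fix B :: "(real ^ 'd) set" assume "B \<in> sets borel"
  then have "\<epsilon> j -` B \<inter> space M \<in> source j"
    using assms by (auto simp: source_def)
  then show "\<epsilon> j -` B \<inter> space (past k) \<in> sets (past k)"
    using assms by (auto simp: sets_past)
qed simp

lemma past_measurable_mono: "j \<le> k \<Longrightarrow> h \<in> past j \<rightarrow>\<^sub>M N \<Longrightarrow> h \<in> past k \<rightarrow>\<^sub>M N"
  using past_mono[of j k] by (auto simp: measurable_def)

lemma past_measurable: "h \<in> past k \<rightarrow>\<^sub>M N \<Longrightarrow> h \<in> M \<rightarrow>\<^sub>M N"
  using past_events[of k] by (auto simp: measurable_def)

text \<open>The sources with index up to \<open>k\<close> and the single source \<open>Suc k\<close>
  form disjoint groups of intersection-stable families, so the sigma-algebras they generate are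
  independent.\<close>

lemma indep_past_noise:
  assumes "X \<in> past k \<rightarrow>\<^sub>M borel"
  shows "distr M borel X \<Otimes>\<^sub>M distr M borel (\<epsilon> (Suc k))
    = distr M (borel \<Otimes>\<^sub>M borel) (\<lambda>\<omega>. (X \<omega>, \<epsilon> (Suc k) \<omega>))"
proof -
  \<comment> \<open>The groups are indexed by booleans because \<open>indep_set\<close> is defined
    as independence of a boolean-indexed family.\<close>
  let ?I = "case_bool {..k} {Suc k}"
  have "indep_sets (\<lambda>b. sigma_sets (space M) (\<Union>i\<in>?I b. source i)) UNIV"
  proof (rule indep_sets_collect_sigma)
    show "indep_sets source (\<Union>b\<in>UNIV. ?I b)"
      by (rule indep_sets_mono_index[OF _ indep_sets_source]) simp
    show "disjoint_family ?I"
      by (auto simp: disjoint_family_on_def split: bool.splits)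
  qed (rule Int_stable_source)
  then have "indep_sets (case_bool (sets (past k)) (sigma_sets (space M) (source (Suc k)))) UNIV"
    by (rule indep_sets_mono_sets) (simp add: sets_past split: bool.split)
  then have "indep_set (sets (past k)) (sigma_sets (space M) (source (Suc k)))"
    unfolding indep_set_def .
  then show ?thesis
  proof (rule pair_distr_eq_distr_pair)
    show "X \<in> M \<rightarrow>\<^sub>M borel" "\<epsilon> (Suc k) \<in> M \<rightarrow>\<^sub>M borel"
      using past_measurable[OF assms] \<epsilon>_meas by auto
    show "X -` B \<inter> space M \<in> sets (past k)" if "B \<in> sets borel" for B
      using measurable_sets[OF assms that] by simp
    show "\<epsilon> (Suc k) -` B \<inter> space M \<in> sigma_sets (space M) (source (Suc k))"
      if "B \<in> sets borel" for B
      using that by (auto simp: source_def)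
  qed
qed

section \<open>The state laws follow \<open>Phi\<close>\<close>

text \<open>Both measure arguments are frozen, and constant maps into \<open>prob_algebra\<close>
  are measurable. What remains is a function of state and noise, in the form required by the mixture
  formula.\<close>

lemma F_policy_measurable:
  assumes a: "a \<in> borel \<rightarrow>\<^sub>M action_space A"
    and \<mu>: "\<mu> \<in> probs borel" and l: "l \<in> probs (action_space A)"
  shows "(\<lambda>(x, e). F (Suc k) x \<mu> (a x) l e) \<in> borel \<Otimes>\<^sub>M borel \<rightarrow>\<^sub>M borel"
proof -
  note [measurable] = a
  have "(\<lambda>p. (fst p, \<mu>, a (fst p), l, snd p)) \<in> borel \<Otimes>\<^sub>M borel
      \<rightarrow>\<^sub>M borel \<Otimes>\<^sub>M prob_algebra borel \<Otimes>\<^sub>M action_space A \<Otimes>\<^sub>M prob_algebra (action_space A) \<Otimes>\<^sub>M borel"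
    using \<mu> l by measurable
  from measurable_compose[OF this F_meas[of k]] show ?thesis
    by (simp add: case_prod_beta')
qed

lemma policy_measurable: "\<alpha> \<in> controls A \<Longrightarrow> \<alpha> k \<in> borel \<rightarrow>\<^sub>M action_space A"
  by (auto simp: controls_def policies_def)

text \<open>The law of the action is the image under \<open>\<alpha> k\<close> of the law of the
  state. The measure arguments of \<open>F\<close> are thus deterministic and determined by
  \<open>\<mu>\<close> and the current policy.\<close>

lemma state_Suc:
  assumes X: "state M A F \<epsilon> \<xi> \<alpha> k \<in> M \<rightarrow>\<^sub>M borel" and \<alpha>: "\<alpha> \<in> controls A"
  defines "\<mu> \<equiv> state_law M A F \<epsilon> \<xi> \<alpha> k"
  shows "state M A F \<epsilon> \<xi> \<alpha> (Suc k)
    = (\<lambda>\<omega>. F (Suc k) (state M A F \<epsilon> \<xi> \<alpha> k \<omega>) \<mu> (\<alpha> k (state M A F \<epsilon> \<xi> \<alpha> k \<omega>))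
            (push A (\<alpha> k) \<mu>) (\<epsilon> (Suc k) \<omega>))"
  using distr_distr[OF policy_measurable[OF \<alpha>, of k] X]
  by (simp add: Let_def \<mu>_def state_law_def push_def comp_def)

lemma state_law_in_probs:
  "state M A F \<epsilon> \<xi> \<alpha> k \<in> M \<rightarrow>\<^sub>M borel \<Longrightarrow> state_law M A F \<epsilon> \<xi> \<alpha> k \<in> probs borel"
  by (simp add: state_law_def space_prob_algebra prob_space_distr)

lemma push_in_probs:
  assumes "a \<in> borel \<rightarrow>\<^sub>M action_space A" "\<mu> \<in> probs borel"
  shows "push A a \<mu> \<in> probs (action_space A)"
  using measurable_space[OF measurable_distr_prob_space[OF assms(1)] assms(2)]
  by (simp add: push_def)

text \<open>The chain is adapted: step \<open>Suc k\<close> adds only the noise with that index.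
  This makes the state at time \<open>k\<close> independent of the next noise.\<close>

lemma state_past:
  assumes \<alpha>: "\<alpha> \<in> controls A"
  shows "state M A F \<epsilon> \<xi> \<alpha> k \<in> past k \<rightarrow>\<^sub>M borel"
proof (induction k)
  case 0
  show ?case by (simp add: \<xi>_past)
next
  case (Suc k)
  let ?X = "state M A F \<epsilon> \<xi> \<alpha> k"
  have XM: "?X \<in> M \<rightarrow>\<^sub>M borel" by (rule past_measurable[OF Suc])
  note \<mu> = state_law_in_probs[OF XM] and a = policy_measurable[OF \<alpha>, of k]
  have "(\<lambda>\<omega>. (?X \<omega>, \<epsilon> (Suc k) \<omega>)) \<in> past (Suc k) \<rightarrow>\<^sub>M borel \<Otimes>\<^sub>M borel"
    by (intro measurable_Pair past_measurable_mono[OF _ Suc] \<epsilon>_past) auto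
  from measurable_compose[OF this F_policy_measurable[OF a \<mu> push_in_probs[OF a \<mu>], of k]]
  show ?case by (simp add: state_Suc[OF XM \<alpha>] del: state.simps)
qed

text \<open>The mean-field arguments carry no randomness, so the only random inputs of a step are
  the state and a noise independent of it. The mixture formula then yields exactly the kernel of
  \<open>transition\<close>.\<close>

lemma state_law_Suc:
  assumes \<alpha>: "\<alpha> \<in> controls A"
  shows "state_law M A F \<epsilon> \<xi> \<alpha> (Suc k) = Phi M A F \<epsilon> (Suc k) (state_law M A F \<epsilon> \<xi> \<alpha> k) (\<alpha> k)"
proof -
  let ?X = "state M A F \<epsilon> \<xi> \<alpha> k"
  have XM: "?X \<in> M \<rightarrow>\<^sub>M borel" by (rule past_measurable[OF state_past[OF \<alpha>]])
  note \<mu> = state_law_in_probs[OF XM] and a = policy_measurable[OF \<alpha>, of k]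
  \<comment> \<open>The law is unfolded at \<open>Suc k\<close> but folded back at \<open>k\<close>,
    so that the right side is recognized as \<open>Phi\<close>.\<close>
  show ?thesis
    using distr_eq_bind_if_product_law[OF XM \<epsilon>_meas indep_past_noise[OF state_past[OF \<alpha>]]
        F_policy_measurable[OF a \<mu> push_in_probs[OF a \<mu>], of k]]
    by (simp add: state_law_def[of M A F \<epsilon> \<xi> \<alpha> "Suc k"] state_law_def[of M A F \<epsilon> \<xi> \<alpha> k, symmetric]
        state_Suc[OF XM \<alpha>] Phi_def transition_def del: state.simps)
qed

section \<open>Dynamic programming by backward induction\<close>

text \<open>The control is kept arbitrary because the induction hypothesis is needed at every
  \<open>\<alpha>(k := a)\<close>. The law of that control at \<open>Suc k\<close> is
  \<open>Phi\<close> of the unchanged law at \<open>k\<close> and of \<open>a\<close>, so both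
  recursions have the same terms.\<close>

theorem dyn_value_eq_value_fun:
  assumes "\<alpha> \<in> controls A" "k \<le> n"
  shows "dyn_value M A F \<epsilon> \<xi> f g n k \<alpha> = value_fun M A F \<epsilon> f g n k (state_law M A F \<epsilon> \<xi> \<alpha> k)"
  using assms(2,1)
proof (induction k arbitrary: \<alpha> rule: inc_induct)
  case base
  then show ?case by (simp add: dyn_value_terminal value_fun.simps[of M A F \<epsilon> f g n n])
next
  case (step k)
  have "dyn_value M A F \<epsilon> \<xi> f g n (Suc k) (\<alpha>(k := a))
      = value_fun M A F \<epsilon> f g n (Suc k) (Phi M A F \<epsilon> (Suc k) (state_law M A F \<epsilon> \<xi> \<alpha> k) a)"
    if "a \<in> policies A" for a
  proof -
    note upd = controls_fun_upd[OF step.prems that, of k]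
    have "state_law M A F \<epsilon> \<xi> (\<alpha>(k := a)) k = state_law M A F \<epsilon> \<xi> \<alpha> k"
      by (rule state_law_cong) simp
    \<comment> \<open>Keeping \<open>fun_upd_apply\<close> out leaves
      \<open>\<alpha>(k := a)\<close> intact as a control, as in \<open>upd\<close>; only its value
      at \<open>k\<close> is evaluated.\<close>
    then show ?thesis
      using step.IH[OF upd] state_law_Suc[OF upd, of k] by (simp del: fun_upd_apply add: fun_upd_same)
  qed
  then show ?case
    using step.hyps by (simp add: dyn_value_step[OF step.prems] value_fun.simps[of M A F \<epsilon> f g n k])
qed

end

theorem theorem3p1:
  fixes M :: "'w measure"
    and A :: "'a::real_normed_vector set"
    and F :: "nat \<Rightarrow> 'e::real_normed_vector \<Rightarrow> 'e measure \<Rightarrow> 'a \<Rightarrow> 'a measure \<Rightarrow> real ^ 'd \<Rightarrow> 'e"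
    and \<epsilon> :: "nat \<Rightarrow> 'w \<Rightarrow> real ^ 'd"
    and \<xi> :: "'w \<Rightarrow> 'e"
    and f :: "nat \<Rightarrow> 'e \<Rightarrow> 'e measure \<Rightarrow> 'a \<Rightarrow> 'a measure \<Rightarrow> real"
    and g :: "'e \<Rightarrow> 'e measure \<Rightarrow> real"
    and n :: nat
  assumes M: "prob_space M"
    and \<epsilon>_indep: "prob_space.indep_vars M (\<lambda>_. borel) \<epsilon> {1..}"
    and \<epsilon>_ident: "\<And>k. k \<ge> 1 \<Longrightarrow> distr M borel (\<epsilon> k) = distr M borel (\<epsilon> 1)"
    and \<xi>_meas: "\<xi> \<in> M \<rightarrow>\<^sub>M borel"
    and \<xi>_sq_int: "integrable M (\<lambda>\<omega>. (norm (\<xi> \<omega>))\<^sup>2)"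
    and \<xi>_\<epsilon>_indep: "prob_space.indep_set M
          (sets (vimage_algebra (space M) \<xi> borel))
          (sets (vimage_algebra (space M) (\<lambda>\<omega>. \<lambda>k\<in>{1..}. \<epsilon> k \<omega>) (\<Pi>\<^sub>M k\<in>{1..}. borel)))"
    and F_meas: "\<And>k. (\<lambda>(x, \<mu>, a, l, e). F (Suc k) x \<mu> a l e)
          \<in> borel \<Otimes>\<^sub>M prob_algebra borel \<Otimes>\<^sub>M action_space A \<Otimes>\<^sub>M prob_algebra (action_space A) \<Otimes>\<^sub>M borel
            \<rightarrow>\<^sub>M borel"
    and F_growth: "\<And>k. \<exists>C>0. \<forall>x. \<forall>\<mu>\<in>probs borel. \<forall>a\<in>A. \<forall>l\<in>probs (action_space A).
          (\<integral>\<^sup>+\<omega>. ennreal ((norm (F (Suc k) x \<mu> a l (\<epsilon> (Suc k) \<omega>)))\<^sup>2) \<partial>M)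
            \<le> ennreal C * (1 + ennreal ((norm x)\<^sup>2) + ennreal ((norm a)\<^sup>2)
                             + second_moment \<mu> + second_moment l)"
    and n: "n \<ge> 1"
    and f_meas: "\<And>k. k < n \<Longrightarrow> (\<lambda>(x, \<mu>, a, l). f k x \<mu> a l)
          \<in> borel \<Otimes>\<^sub>M prob_algebra2 borel \<Otimes>\<^sub>M action_space A \<Otimes>\<^sub>M prob_algebra2 (action_space A)
            \<rightarrow>\<^sub>M borel"
    and f_growth: "\<And>k. k < n \<Longrightarrow>
          \<exists>C>0. \<forall>x. \<forall>\<mu>\<in>probs2 borel. \<forall>a\<in>A. \<forall>l\<in>probs2 (action_space A).
            ennreal \<bar>f k x \<mu> a l\<bar>
              \<le> ennreal C * (1 + ennreal ((norm x)\<^sup>2) + ennreal ((norm a)\<^sup>2)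
                               + second_moment \<mu> + second_moment l)"
    and g_meas: "(\<lambda>(x, \<mu>). g x \<mu>) \<in> borel \<Otimes>\<^sub>M prob_algebra2 borel \<rightarrow>\<^sub>M borel"
    and g_growth: "\<exists>C>0. \<forall>x. \<forall>\<mu>\<in>probs2 borel.
          ennreal \<bar>g x \<mu>\<bar> \<le> ennreal C * (1 + ennreal ((norm x)\<^sup>2) + second_moment \<mu>)"
    and V_finite: "\<And>k \<alpha>. k \<le> n \<Longrightarrow> \<alpha> \<in> controls A \<Longrightarrow> dyn_value M A F \<epsilon> \<xi> f g n k \<alpha> > -\<infinity>"
  shows "\<forall>\<alpha>\<in>controls A. \<forall>k\<le>n.
           dyn_value M A F \<epsilon> \<xi> f g n k \<alpha>
           = value_fun M A F \<epsilon> f g n k (state_law M A F \<epsilon> \<xi> \<alpha> k)"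
proof -
  interpret mean_field_chain M A F \<epsilon> \<xi>
    using M \<epsilon>_indep \<xi>_meas \<xi>_\<epsilon>_indep F_meas
    by (intro mean_field_chain.intro mean_field_chain_axioms.intro)
  show ?thesis by (simp add: dyn_value_eq_value_fun)
qed

end
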